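(* Let $\lambda$ be a strict partition and let $n$ be a positive integer such that $\mathrm{SSVT}_P(\lambda,n)\neq\emptyset$ and $\mathrm{SSVT}_Q(\lambda,n)\neq\emptyset$. Then, as Laurent polynomials in $\beta$, $$GP_{\lambda}(\beta,\dots,\beta \mid -\beta^{-1})=\beta^{|\lambda|},\qquad GQ_{\lambda}(\beta,\dots,\beta \mid -\beta^{-1})=\beta^{|\lambda|},$$ where all $n$ variables $x_1,\dots,x_n$ are specialized to $\beta$ and the parameter is specialized to $-\beta^{-1}$.
   Context: A strict partition is $\lambda=(\lambda_1>\lambda_2>\dots>\lambda_r>0)$; $\ell(\lambda)=r$, $|\lambda|=\sum_i\lambda_i$. Its shifted Young diagram is $\mathrm{SYD}_\lambda=\{(i,j): 1\le i\le \ell(\lambda),\ i\le j\le \lambda_i+i-1\}$ (row index $i$, column index $j$); boxes $(i,i)$ are the diagonal boxes. For $k\in[n]=\{1,\dots,n\}$ put $k'=k-\tfrac12$, and let $[n',n]=\{1'<1<2'<2<\dots<n'<n\}$. A shifted set-valued tableau of shape $\lambda$ with $n$ variables is a map $T$ assigning to each box $(i,j)\in\mathrm{SYD}_\lambda$ a nonempty subset $T_{i,j}\subseteq[n',n]$ such that: (1) $\max T_{i,j}\le \min T_{i,j+1}$ and $\max T_{i,j}\le\min T_{i+1,j}$ whenever the boxes exist; (2) each unprimed $k\in[n]$ appears at most once in each column; (3) each primed $k'$ appears at most once in each row; (4) $T_{i,i}\subseteq[n]$ for diagonal boxes. $\mathrm{SSVT}_P(\lambda,n)$ is the set of such tableaux,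 and $\mathrm{SSVT}_Q(\lambda,n)$ is the set of maps satisfying (1)–(3) but not necessarily (4). For such $T$, $|T|$ is the total number of entries (sum of the sizes of all $T_{i,j}$), $\omega_k(T)$ is the number of occurrences of $k$ or $k'$ in $T$, and $x^{\omega(T)}=\prod_{k=1}^n x_k^{\omega_k(T)}$. Define $GP_\lambda(x\mid\beta)=\sum_{T\in\mathrm{SSVT}_P(\lambda,n)}\beta^{|T|-|\lambda|}x^{\omega(T)}$ and $GQ_\lambda(x\mid\beta)=\sum_{T\in\mathrm{SSVT}_Q(\lambda,n)}\beta^{|T|-|\lambda|}x^{\omega(T)}$. *)

theory Defs
  imports Complex_Main "HOL-Library.FuncSet" "HOL-Library.Poly_Mapping"
begin

definition strict_partition :: "nat list \<Rightarrow> bool" where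
  "strict_partition lam \<longleftrightarrow> sorted_wrt (>) lam \<and> (\<forall>p\<in>set lam. 0 < p)"

(* Rows and columns are numbered from 1, so the part in row i is lam ! (i - 1). *)
definition SYD :: "nat list \<Rightarrow> (nat \<times> nat) set" where
  "SYD lam = {(i, j). 1 \<le> i \<and> i \<le> length lam \<and> i \<le> j \<and> j \<le> lam ! (i - 1) + i - 1}"

(* Entries are rational numbers: k is of_nat k and k' is k - 1/2, so the order
   1' < 1 < 2' < 2 < ... is the usual one. *)
definition primed :: "nat \<Rightarrow> rat" where
  "primed k = of_nat k - 1 / 2"

definition unprimed :: "nat \<Rightarrow> rat" where
  "unprimed k = of_nat k"

definition alphabet :: "nat \<Rightarrow> rat set" where
  "alphabet n = primed ` {1..n} \<union> unprimed ` {1..n}"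

(* Tableaux are extensional functions, so that each map on the boxes of the
   diagram is counted exactly once. *)
definition SSVT_Q :: "nat list \<Rightarrow> nat \<Rightarrow> (nat \<times> nat \<Rightarrow> rat set) set" where
  "SSVT_Q lam n =
    {T \<in> SYD lam \<rightarrow>\<^sub>E (Pow (alphabet n) - {{}}).
      (\<forall>i j. (i, j) \<in> SYD lam \<and> (i, j + 1) \<in> SYD lam \<longrightarrow> Max (T (i, j)) \<le> Min (T (i, j + 1))) \<and>
      (\<forall>i j. (i, j) \<in> SYD lam \<and> (i + 1, j) \<in> SYD lam \<longrightarrow> Max (T (i, j)) \<le> Min (T (i + 1, j))) \<and>
      (\<forall>k\<in>{1..n}. \<forall>j i1 i2. (i1, j) \<in> SYD lam \<and> (i2, j) \<in> SYD lam \<and>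
         unprimed k \<in> T (i1, j) \<and> unprimed k \<in> T (i2, j) \<longrightarrow> i1 = i2) \<and>
      (\<forall>k\<in>{1..n}. \<forall>i j1 j2. (i, j1) \<in> SYD lam \<and> (i, j2) \<in> SYD lam \<and>
         primed k \<in> T (i, j1) \<and> primed k \<in> T (i, j2) \<longrightarrow> j1 = j2)}"

definition SSVT_P :: "nat list \<Rightarrow> nat \<Rightarrow> (nat \<times> nat \<Rightarrow> rat set) set" where
  "SSVT_P lam n =
    {T \<in> SSVT_Q lam n. \<forall>i. (i, i) \<in> SYD lam \<longrightarrow> T (i, i) \<subseteq> unprimed ` {1..n}}"

definition tab_size :: "nat list \<Rightarrow> (nat \<times> nat \<Rightarrow> rat set) \<Rightarrow> nat" where
  "tab_size lam T = (\<Sum>b\<in>SYD lam. card (T b))"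

definition weight :: "nat list \<Rightarrow> (nat \<times> nat \<Rightarrow> rat set) \<Rightarrow> nat \<Rightarrow> nat" where
  "weight lam T k = (\<Sum>b\<in>SYD lam. card (T b \<inter> {unprimed k, primed k}))"

(* GP and GQ are given by their values in an arbitrary commutative ring: x k is the
   value of the k-th variable and b the value of the parameter. The subtraction in
   the exponent does not truncate, because every box holds at least one entry and
   the number of boxes is sum_list lam. *)
definition GP :: "nat list \<Rightarrow> nat \<Rightarrow> (nat \<Rightarrow> 'a) \<Rightarrow> 'a \<Rightarrow> 'a::comm_ring_1" where
  "GP lam n x b =
    (\<Sum>T\<in>SSVT_P lam n. b ^ (tab_size lam T - sum_list lam) * (\<Prod>k=1..n. x k ^ weight lam T k))"

definition GQ :: "nat list \<Rightarrow> nat \<Rightarrow> (nat \<Rightarrow> 'a) \<Rightarrow> 'a \<Rightarrow> 'a::comm_ring_1" where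
  "GQ lam n x b =
    (\<Sum>T\<in>SSVT_Q lam n. b ^ (tab_size lam T - sum_list lam) * (\<Prod>k=1..n. x k ^ weight lam T k))"

(* Finitely supported functions from exponents in int to coefficients in int, with
   the convolution product, are the ring of integer Laurent polynomials. *)
type_synonym laurent_poly = "int \<Rightarrow>\<^sub>0 int"

definition lbeta :: laurent_poly where
  "lbeta = Poly_Mapping.single 1 1"

definition lbeta_inv :: laurent_poly where
  "lbeta_inv = Poly_Mapping.single (- 1) 1"

lemma lbeta_mult_inv: "lbeta * lbeta_inv = 1"
  by (simp add: lbeta_def lbeta_inv_def mult_single)

(* Needed for the sums in GP and GQ not to be 0 by convention. *)
lemma finite_SYD: "finite (SYD lam)"
proof -
  have "SYD lam \<subseteq> {1..length lam} \<times> {..sum_list lam + length lam}"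
  proof
    fix b assume "b \<in> SYD lam"
    then obtain i j where b: "b = (i, j)" "1 \<le> i" "i \<le> length lam" "j \<le> lam ! (i - 1) + i - 1"
      by (auto simp: SYD_def)
    have "lam ! (i - 1) \<le> sum_list lam"
      using b by (intro elem_le_sum_list) auto
    then show "b \<in> {1..length lam} \<times> {..sum_list lam + length lam}"
      using b by auto
  qed
  then show ?thesis
    by (rule finite_subset) auto
qed

lemma finite_SSVT_Q: "finite (SSVT_Q lam n)"
proof (rule finite_subset)
  show "SSVT_Q lam n \<subseteq> SYD lam \<rightarrow>\<^sub>E (Pow (alphabet n) - {{}})"
    by (auto simp: SSVT_Q_def)
  show "finite (SYD lam \<rightarrow>\<^sub>E (Pow (alphabet n) - {{}}))"
    by (intro finite_PiE finite_SYD) (auto simp: alphabet_def)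
qed

lemma finite_SSVT_P: "finite (SSVT_P lam n)"
  by (rule finite_subset[OF _ finite_SSVT_Q]) (auto simp: SSVT_P_def)

end

theory Submission
  imports Defs
begin

text \<open>
  After the specialization every tableau contributes \<open>\<beta>\<close> to the power \<open>|\<lambda>|\<close> up to the sign
  \<open>(-1)^(|T| - |\<lambda>|)\<close>, so the tableaux have to be counted with signs. The pointwise minimum \<open>m\<close>
  of all tableaux is again a tableau, with one entry per box. In any other tableau \<open>T\<close> pick a box
  \<open>b\<close> of minimal rank \<open>i + j\<close> with \<open>T b \<noteq> {m b}\<close> and insert \<open>m b\<close> into \<open>T b\<close>, or remove it if
  present. The boxes to the left of and above \<open>b\<close> agree with \<open>m\<close>, and \<open>T b\<close> contains an entry
  larger than \<open>m b\<close>, so all conditions survive. This is a sign-reversing involution, and only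
  the minimal tableau remains.
\<close>

section \<open>Signed count of set-valued fillings\<close>

text \<open>\<open>E a b\<close> says that the box \<open>a\<close> precedes the box \<open>b\<close>, and \<open>W a b\<close> is the set of letters that
  may occur in both.\<close>

definition set_fillings ::
  "'b set \<Rightarrow> ('b \<Rightarrow> 'c::linorder set) \<Rightarrow> ('b \<Rightarrow> 'b \<Rightarrow> bool) \<Rightarrow> ('b \<Rightarrow> 'b \<Rightarrow> 'c set) \<Rightarrow> ('b \<Rightarrow> 'c set) set"
  where
  "set_fillings B A E W =
    {T \<in> PiE B (\<lambda>b. Pow (A b) - {{}}).
      \<forall>a\<in>B. \<forall>b\<in>B. E a b \<longrightarrow> (\<forall>x\<in>T a. \<forall>y\<in>T b. x < y \<or> x = y \<and> x \<in> W a b)}"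

lemma set_fillings_cell:
  assumes "T \<in> set_fillings B A E W" "b \<in> B"
  shows "T b \<noteq> {}" "T b \<subseteq> A b"
  using assms by (auto simp: set_fillings_def PiE_iff)

lemma finite_set_fillings:
  assumes "finite B" "\<And>b. b \<in> B \<Longrightarrow> finite (A b)"
  shows "finite (set_fillings B A E W)"
  by (rule finite_subset[of _ "PiE B (\<lambda>b. Pow (A b) - {{}})"])
    (auto simp: set_fillings_def intro!: finite_PiE assms)

text \<open>For a pair \<open>E a b\<close>, a filling with \<open>m b\<close> among its entries in
  \<open>b\<close> has some entry \<open>x\<close> in \<open>a\<close>, and
  \<open>m a \<le> x \<le> m b\<close>. If \<open>m a = m b\<close>, then \<open>x\<close> equals
  both, hence lies in \<open>W a b\<close>.\<close>

lemma set_fillings_minimum: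
  fixes A :: "'b \<Rightarrow> 'c::linorder set"
  assumes B: "finite B" and A: "\<And>b. b \<in> B \<Longrightarrow> finite (A b)"
    and ne: "set_fillings B A E W \<noteq> {}"
  obtains m where "(\<lambda>b\<in>B. {m b}) \<in> set_fillings B A E W"
    and "\<And>T b x. T \<in> set_fillings B A E W \<Longrightarrow> b \<in> B \<Longrightarrow> x \<in> T b \<Longrightarrow> m b \<le> x"
proof -
  let ?S = "set_fillings B A E W"
  have fin: "finite (\<Union>T\<in>?S. T b)" if "b \<in> B" for b
    by (rule finite_subset[OF _ A[OF that]]) (use that in \<open>auto simp: set_fillings_def PiE_iff\<close>)
  have nonempty: "(\<Union>T\<in>?S. T b) \<noteq> {}" if "b \<in> B" for b
  proof -
    obtain T where "T \<in> ?S" using ne by blast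
    then show ?thesis using set_fillings_cell(1)[OF _ that] by fast
  qed
  define m where "m b = Min (\<Union>T\<in>?S. T b)" for b
  have le: "m b \<le> x" if "T \<in> ?S" "b \<in> B" "x \<in> T b" for T b x
    unfolding m_def using that fin by (intro Min_le) auto
  have attained: "\<exists>T\<in>?S. m b \<in> T b" if "b \<in> B" for b
    using Min_in[OF fin nonempty, OF that that] by (simp add: m_def)
  have mA: "m b \<in> A b" if "b \<in> B" for b
    using attained[OF that] that by (auto simp: set_fillings_def PiE_iff)
  have edge: "m a < m b \<or> m a = m b \<and> m a \<in> W a b" if ab: "a \<in> B" "b \<in> B" "E a b" for a b
  proof -
    obtain T where T: "T \<in> ?S" "m b \<in> T b" using attained ab by blast
    obtain x where x: "x \<in> T a" using set_fillings_cell(1)[OF T(1) ab(1)] by blast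
    have "x < m b \<or> x = m b \<and> x \<in> W a b"
      using T x ab by (auto simp: set_fillings_def)
    with le[OF T(1) ab(1) x] show ?thesis by auto
  qed
  have "(\<lambda>b\<in>B. {m b}) \<in> ?S"
    using mA edge by (auto simp: set_fillings_def)
  then show ?thesis using le that by blast
qed

text \<open>Predecessors of \<open>b\<close> hold only their minima, so \<open>m b\<close> may
  follow them as it does in the minimal filling. Successors of \<open>b\<close> are bounded from
  below by an entry of \<open>T b\<close> above \<open>m b\<close>.\<close>

lemma set_fillings_toggle:
  assumes T: "T \<in> set_fillings B A E W"
    and M: "(\<lambda>b\<in>B. {m b}) \<in> set_fillings B A E W"
    and least: "\<And>x. x \<in> T b \<Longrightarrow> m b \<le> x"
    and b: "b \<in> B" "T b \<noteq> {m b}"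
    and before: "\<And>a. a \<in> B \<Longrightarrow> E a b \<Longrightarrow> T a = {m a}"
    and irrefl: "\<not> E b b"
  shows "T(b := sym_diff (T b) {m b}) \<in> set_fillings B A E W"
proof -
  let ?T = "T(b := sym_diff (T b) {m b})"
  have Tb: "T b \<noteq> {}" "T b \<subseteq> A b" and mb: "m b \<in> A b"
    using set_fillings_cell[OF T b(1)] set_fillings_cell[OF M b(1)] b(1) by auto
  \<comment> \<open>The entry \<open>z\<close> survives the toggle, which keeps the box nonempty.
    Every later entry is at least \<open>z\<close>, hence strictly above an inserted
    \<open>m b\<close>.\<close>
  then obtain z where z: "z \<in> T b" "m b < z"
    using b(2) least by (metis insertI1 order_le_less singletonD subsetI subset_singletonD)
  have "?T \<in> PiE B (\<lambda>b. Pow (A b) - {{}})"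
  proof (rule PiE_I)
    show "?T c \<in> Pow (A c) - {{}}" if "c \<in> B" for c
      using set_fillings_cell[OF T that] z Tb mb by auto
    show "?T c = undefined" if "c \<notin> B" for c
      using T b(1) that by (auto simp: set_fillings_def PiE_iff extensional_def)
  qed
  moreover have "x < y \<or> x = y \<and> x \<in> W c d"
    if cd: "c \<in> B" "d \<in> B" "E c d" and xy: "x \<in> ?T c" "y \<in> ?T d" for c d x y
  proof -
    have T_edge: "u < v \<or> u = v \<and> u \<in> W c d" if "u \<in> T c" "v \<in> T d" for u v
      using T cd that by (auto simp: set_fillings_def)
    have M_edge: "m c < m d \<or> m c = m d \<and> m c \<in> W c d"
      using M cd by (auto simp: set_fillings_def)
    consider "c = b" "d \<noteq> b" | "d = b" "c \<noteq> b" | "c \<noteq> b" "d \<noteq> b"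
      using irrefl cd by blast
    then show ?thesis
    proof cases
      case 1
      with xy have "x \<in> T c \<or> x = m b" "y \<in> T d" by auto
      then show ?thesis
        using T_edge[of x y] T_edge[of z y] z 1 by force
    next
      case 2
      with xy before cd have "x = m c" "x \<in> T c" "y \<in> T d \<or> y = m d" by auto
      then show ?thesis using T_edge[of x y] M_edge by auto
    next
      case 3
      with xy T_edge show ?thesis by auto
    qed
  qed
  ultimately show ?thesis by (auto simp: set_fillings_def simp del: fun_upd_apply)
qed

lemma card_sym_diff_singleton:
  assumes "finite X"
  shows "(-1 :: int) ^ card (sym_diff X {x}) = - ((-1) ^ card X)"
proof (cases "x \<in> X")
  case True
  then have "sym_diff X {x} = X - {x}" by auto
  moreover have "card X = Suc (card (X - {x}))" by (rule card.remove[OF assms True])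
  ultimately show ?thesis by simp
next
  case False
  then have "sym_diff X {x} = insert x X" by auto
  then show ?thesis using False assms by simp
qed

theorem set_fillings_signed_count:
  fixes A :: "'b \<Rightarrow> 'c::linorder set" and r :: "'b \<Rightarrow> nat"
  assumes B: "finite B" and A: "\<And>b. b \<in> B \<Longrightarrow> finite (A b)"
    and rank: "\<And>a b. E a b \<Longrightarrow> r a < r b"
    and ne: "set_fillings B A E W \<noteq> {}"
  shows "(\<Sum>T\<in>set_fillings B A E W. (-1 :: int) ^ (\<Sum>b\<in>B. card (T b))) = (-1) ^ card B"
proof -
  let ?S = "set_fillings B A E W"
  let ?sgn = "\<lambda>T. (-1 :: int) ^ (\<Sum>b\<in>B. card (T b))"
  obtain m where M: "(\<lambda>b\<in>B. {m b}) \<in> ?S"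
    and least: "\<And>T b x. T \<in> ?S \<Longrightarrow> b \<in> B \<Longrightarrow> x \<in> T b \<Longrightarrow> m b \<le> x"
    using set_fillings_minimum[OF B A ne] by metis
  define M where "M = (\<lambda>b\<in>B. {m b})"
  define D where "D T = {b \<in> B. T b \<noteq> {m b}}" for T
  \<comment> \<open>Ties in rank are broken by a choice that depends on \<open>T\<close> only
    through \<open>D T\<close>. As toggling preserves \<open>D T\<close>, the same box is found
    again and the second toggle undoes the first.\<close>
  define p where "p T = arg_min r (\<lambda>b. b \<in> D T)" for T
  define f where "f T = T(p T := sym_diff (T (p T)) {m (p T)})" for T
  have D_ne: "D T \<noteq> {}" if "T \<in> ?S - {M}" for T
  proof
    assume "D T = {}"
    \<comment> \<open>Outside \<open>B\<close> both fillings are \<open>undefined\<close> by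
      extensionality.\<close>
    then have "T b = M b" for b
      using that unfolding D_def M_def set_fillings_def PiE_iff extensional_def by auto
    with that show False by auto
  qed
  have p: "p T \<in> D T" "\<And>a. a \<in> D T \<Longrightarrow> r (p T) \<le> r a" if T: "T \<in> ?S - {M}" for T
  proof -
    obtain a where a: "a \<in> D T" using D_ne[OF T] by blast
    show "p T \<in> D T" unfolding p_def by (rule arg_min_natI[of "\<lambda>b. b \<in> D T", OF a])
    show "\<And>a. a \<in> D T \<Longrightarrow> r (p T) \<le> r a"
      unfolding p_def by (rule arg_min_nat_le)
  qed
  have D_f: "D (f T) = D T" if T: "T \<in> ?S - {M}" for T
  proof -
    have "T (p T) \<noteq> {}" "T (p T) \<noteq> {m (p T)}"
      using p(1)[OF T] T by (auto simp: D_def set_fillings_def PiE_iff)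
    \<comment> \<open>Only an empty cell could become \<open>{m (p T)}\<close>.\<close>
    then have "sym_diff (T (p T)) {m (p T)} \<noteq> {m (p T)}" by auto
    then show ?thesis using p(1)[OF T] by (auto simp: D_def f_def)
  qed
  have f_f: "f (f T) = T" if T: "T \<in> ?S - {M}" for T
  proof -
    have "p (f T) = p T" using D_f[OF T] by (simp add: p_def)
    then show ?thesis unfolding f_def by (auto simp: fun_eq_iff f_def)
  qed
  have f_S: "f T \<in> ?S - {M}" if T: "T \<in> ?S - {M}" for T
  proof -
    have "f T \<in> ?S" unfolding f_def
    proof (rule set_fillings_toggle[OF _ M])
      show "T \<in> ?S" "p T \<in> B" "T (p T) \<noteq> {m (p T)}"
        using T p(1)[OF T] by (auto simp: D_def)
      then show "m (p T) \<le> x" if "x \<in> T (p T)" for x using least that by blast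
      show "\<not> E (p T) (p T)" using rank by blast
      \<comment> \<open>A predecessor has smaller rank than \<open>p T\<close>, so minimality keeps
        it out of \<open>D T\<close>.\<close>
      show "T a = {m a}" if "a \<in> B" "E a (p T)" for a
        using p(2)[OF T, of a] rank[OF that(2)] that(1) by (auto simp: D_def)
    qed
    moreover have "D M = {}" by (auto simp: D_def M_def)
    ultimately show ?thesis using D_f[OF T] D_ne[OF T] by auto
  qed
  have sgn_f: "?sgn (f T) = - ?sgn T" if T: "T \<in> ?S - {M}" for T
  proof -
    have pB: "p T \<in> B" using p(1)[OF T] by (simp add: D_def)
    have "T (p T) \<subseteq> A (p T)" using T pB by (auto simp: set_fillings_def PiE_iff)
    then have "finite (T (p T))" using A[OF pB] finite_subset by blast
    then have "(-1 :: int) ^ card (f T (p T)) = - ((-1) ^ card (T (p T)))"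
      by (simp add: f_def card_sym_diff_singleton)
    moreover have "(\<Sum>b\<in>B - {p T}. card (f T b)) = (\<Sum>b\<in>B - {p T}. card (T b))"
      by (rule sum.cong) (auto simp: f_def)
    ultimately show ?thesis
      by (simp add: sum.remove[OF B pB] power_add)
  qed
  \<comment> \<open>Reindexing by the involution \<open>f\<close> makes the sum its own negative,
    and in \<open>int\<close> this forces it to be 0.\<close>
  have "(\<Sum>T\<in>?S - {M}. ?sgn T) = (\<Sum>T\<in>?S - {M}. - ?sgn T)"
    by (rule sum.reindex_bij_witness[of _ f f]) (use f_f f_S sgn_f in auto)
  then have "(\<Sum>T\<in>?S - {M}. ?sgn T) = 0" by (simp add: sum_negf)
  moreover have "M \<in> ?S" using M by (simp add: M_def)
  moreover have "?sgn M = (-1) ^ card B" by (simp add: M_def)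
  ultimately show ?thesis
    using sum.remove[where x = M and g = ?sgn, OF finite_set_fillings[where E = E and W = W, OF B A]]
    by simp
qed

section \<open>Shifted tableaux as set-valued fillings\<close>

text \<open>All pairs in a line are related, not only neighbours, so that the at-most-once
  conditions on whole rows and columns become conditions on pairs.\<close>

fun same_line_before :: "nat \<times> nat \<Rightarrow> nat \<times> nat \<Rightarrow> bool" where
  "same_line_before (i1, j1) (i2, j2) \<longleftrightarrow> i1 = i2 \<and> j1 < j2 \<or> j1 = j2 \<and> i1 < i2"

text \<open>For boxes related by \<open>same_line_before\<close>, different rows mean a common
  column, so the second branch is the column rule.\<close>

definition repeatable :: "nat \<Rightarrow> nat \<times> nat \<Rightarrow> nat \<times> nat \<Rightarrow> rat set" where
  "repeatable n a b = (if fst a = fst b then - primed ` {1..n} else - unprimed ` {1..n})"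

text \<open>The diagonal condition concerns single boxes, so it can be absorbed into the alphabet
  while the pair conditions stay those of \<open>SSVT_Q\<close>.\<close>

definition P_alphabet :: "nat \<Rightarrow> nat \<times> nat \<Rightarrow> rat set" where
  "P_alphabet n b = (if fst b = snd b then unprimed ` {1..n} else alphabet n)"

lemma finite_alphabet: "finite (alphabet n)"
  by (simp add: alphabet_def)

text \<open>Carries the tableau inequality from neighbours to distant boxes of a line; each nonempty
  set in between contributes \<open>Min \<le> Max\<close>.\<close>

lemma Max_le_Min_chain:
  fixes F :: "nat \<Rightarrow> 'a::linorder set"
  assumes "a < b"
    and "\<And>j. a \<le> j \<Longrightarrow> j \<le> b \<Longrightarrow> finite (F j) \<and> F j \<noteq> {}"
    and "\<And>j. a \<le> j \<Longrightarrow> j < b \<Longrightarrow> Max (F j) \<le> Min (F (j + 1))"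
  shows "Max (F a) \<le> Min (F b)"
  using assms
proof (induction b)
  case 0
  then show ?case by simp
next
  case (Suc b)
  show ?case
  proof (cases "a = b")
    case True
    then show ?thesis using Suc.prems(3)[of b] by simp
  next
    case False
    then have "a < b" using Suc.prems(1) by simp
    have "Max (F a) \<le> Min (F b)"
      by (rule Suc.IH[OF \<open>a < b\<close>]) (use Suc.prems(2,3) in auto)
    also have "\<dots> \<le> Max (F b)"
      using Suc.prems(2)[of b] \<open>a < b\<close> by (intro Min.coboundedI Max_in) auto
    also have "\<dots> \<le> Min (F (Suc b))" using Suc.prems(3)[of b] \<open>a < b\<close> by simp
    finally show ?thesis .
  qed
qed

lemma SYD_row_between:
  assumes "(i, j1) \<in> SYD lam" "(i, j2) \<in> SYD lam" "j1 \<le> j" "j \<le> j2"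
  shows "(i, j) \<in> SYD lam"
  using assms by (auto simp: SYD_def)

lemma SYD_column_between:
  assumes lam: "strict_partition lam"
    and "(i1, j) \<in> SYD lam" "(i2, j) \<in> SYD lam" "i1 \<le> i" "i \<le> i2"
  shows "(i, j) \<in> SYD lam"
proof -
  have "1 \<le> i1" using assms by (auto simp: SYD_def)
  show ?thesis
    using \<open>i \<le> i2\<close> \<open>i1 \<le> i\<close>
  proof (induction rule: inc_induct)
    case base
    show ?case by fact
  next
    case (step k)
    then have k: "(Suc k, j) \<in> SYD lam" "1 \<le> k" using \<open>1 \<le> i1\<close> by auto
    \<comment> \<open>These are the parts of rows \<open>k\<close> and \<open>Suc k\<close>. The
      shift moves each row one column to the right, and the strict decrease makes up for it: row
      \<open>k\<close> ends no earlier than row \<open>Suc k\<close>.\<close>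
    then have "lam ! (k - 1) > lam ! k"
      using lam by (auto simp: strict_partition_def sorted_wrt_iff_nth_less SYD_def)
    with k show ?case by (auto simp: SYD_def)
  qed
qed

text \<open>From left to right, lines of the diagram have no gaps, so neighbour inequalities chain
  to weak ones, and the at-most-once conditions exclude the forbidden equalities. Conversely,
  neighbours are related pairs, and a forbidden repetition contradicts the pair condition once its
  two boxes are ordered.\<close>

lemma SSVT_Q_eq_set_fillings:
  assumes lam: "strict_partition lam"
  shows "SSVT_Q lam n = set_fillings (SYD lam) (\<lambda>_. alphabet n) same_line_before (repeatable n)"
    (is "_ = ?S")
proof (intro set_eqI iffI)
  fix T
  assume T: "T \<in> SSVT_Q lam n"
  have cell: "finite (T b) \<and> T b \<noteq> {}" "T b \<subseteq> alphabet n" if "b \<in> SYD lam" for b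
    using T that finite_subset[OF _ finite_alphabet] by (auto simp: SSVT_Q_def PiE_iff)
  have le: "x \<le> y" if "Max (T a) \<le> Min (T b)" "x \<in> T a" "y \<in> T b" "a \<in> SYD lam" "b \<in> SYD lam"
    for a b x y
  proof -
    have "x \<le> Max (T a)" "Min (T b) \<le> y" using cell that by auto
    with that(1) show ?thesis by simp
  qed
  have row: "x < y \<or> x = y \<and> x \<notin> primed ` {1..n}"
    if box: "(i, j1) \<in> SYD lam" "(i, j2) \<in> SYD lam" "j1 < j2"
      and xy: "x \<in> T (i, j1)" "y \<in> T (i, j2)" for i j1 j2 x y
  proof -
    have between: "(i, j) \<in> SYD lam" if "j1 \<le> j" "j \<le> j2" for j
      using SYD_row_between box that by blast
    have "Max (T (i, j1)) \<le> Min (T (i, j2))"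
    proof (rule Max_le_Min_chain[of j1 j2 "\<lambda>j. T (i, j)", OF box(3)])
      show "Max (T (i, j)) \<le> Min (T (i, j + 1))" if "j1 \<le> j" "j < j2" for j
        using T between[of j] between[of "j + 1"] that by (auto simp: SSVT_Q_def)
    qed (use between cell in auto)
    then have "x \<le> y" using le box xy by blast
    moreover have "x \<noteq> y" if "x \<in> primed ` {1..n}"
      using T box xy that unfolding SSVT_Q_def by blast
    ultimately show ?thesis by auto
  qed
  have column: "x < y \<or> x = y \<and> x \<notin> unprimed ` {1..n}"
    if box: "(i1, j) \<in> SYD lam" "(i2, j) \<in> SYD lam" "i1 < i2"
      and xy: "x \<in> T (i1, j)" "y \<in> T (i2, j)" for i1 i2 j x y
  proof -
    have between: "(i, j) \<in> SYD lam" if "i1 \<le> i" "i \<le> i2" for i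
      using SYD_column_between[OF lam] box that by blast
    have "Max (T (i1, j)) \<le> Min (T (i2, j))"
    proof (rule Max_le_Min_chain[of i1 i2 "\<lambda>i. T (i, j)", OF box(3)])
      show "Max (T (i, j)) \<le> Min (T (i + 1, j))" if "i1 \<le> i" "i < i2" for i
        using T between[of i] between[of "i + 1"] that by (auto simp: SSVT_Q_def)
    qed (use between cell in auto)
    then have "x \<le> y" using le box xy by blast
    moreover have "x \<noteq> y" if "x \<in> unprimed ` {1..n}"
      using T box xy that unfolding SSVT_Q_def by blast
    ultimately show ?thesis by auto
  qed
  have "x < y \<or> x = y \<and> x \<in> repeatable n a b"
    if "a \<in> SYD lam" "b \<in> SYD lam" "same_line_before a b" "x \<in> T a" "y \<in> T b" for a b x y
  proof (cases "fst a = fst b")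
    case True
    then show ?thesis using row[of "fst a" "snd a" "snd b" x y] that
      by (cases a; cases b) (simp add: repeatable_def)
  next
    case False
    then show ?thesis using column[of "fst a" "snd a" "fst b" x y] that
      by (cases a; cases b) (simp add: repeatable_def)
  qed
  moreover have "T \<in> SYD lam \<rightarrow>\<^sub>E (Pow (alphabet n) - {{}})"
    using T by (simp add: SSVT_Q_def)
  ultimately show "T \<in> ?S" unfolding set_fillings_def by blast
next
  fix T
  assume T: "T \<in> ?S"
  have cell: "finite (T b)" "T b \<noteq> {}" if "b \<in> SYD lam" for b
    using T that finite_subset[OF _ finite_alphabet] by (auto simp: set_fillings_def PiE_iff)
  have edge: "x < y \<or> x = y \<and> x \<in> repeatable n a b"
    if "same_line_before a b" "a \<in> SYD lam" "b \<in> SYD lam" "x \<in> T a" "y \<in> T b" for a b x y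
    using T that unfolding set_fillings_def by blast
  have le: "Max (T a) \<le> Min (T b)" if "same_line_before a b" "a \<in> SYD lam" "b \<in> SYD lam" for a b
    using edge[OF that Max_in[OF cell[OF that(2)]] Min_in[OF cell[OF that(3)]]] by auto
  have column: False
    if "k \<in> {1..n}" "(i1, j) \<in> SYD lam" "(i2, j) \<in> SYD lam"
      "unprimed k \<in> T (i1, j)" "unprimed k \<in> T (i2, j)" "i1 < i2" for k i1 i2 j
    using edge[of "(i1, j)" "(i2, j)" "unprimed k" "unprimed k"] that
    by (auto simp: repeatable_def)
  have row: False
    if "k \<in> {1..n}" "(i, j1) \<in> SYD lam" "(i, j2) \<in> SYD lam"
      "primed k \<in> T (i, j1)" "primed k \<in> T (i, j2)" "j1 < j2" for k i j1 j2
    using edge[of "(i, j1)" "(i, j2)" "primed k" "primed k"] that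
    by (auto simp: repeatable_def)
  have adjacent: "same_line_before (i, j) (i, j + 1)" "same_line_before (i, j) (i + 1, j)" for i j
    by simp_all
  have column_eq: "i1 = i2"
    if "k \<in> {1..n}" "(i1, j) \<in> SYD lam" "(i2, j) \<in> SYD lam"
      "unprimed k \<in> T (i1, j)" "unprimed k \<in> T (i2, j)" for k i1 i2 j
    using column[of k i1 j i2] column[of k i2 j i1] that linorder_neqE_nat by blast
  have row_eq: "j1 = j2"
    if "k \<in> {1..n}" "(i, j1) \<in> SYD lam" "(i, j2) \<in> SYD lam"
      "primed k \<in> T (i, j1)" "primed k \<in> T (i, j2)" for k i j1 j2
    using row[of k i j1 j2] row[of k i j2 j1] that linorder_neqE_nat by blast
  have "T \<in> SYD lam \<rightarrow>\<^sub>E (Pow (alphabet n) - {{}})"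
    using T by (simp add: set_fillings_def)
  then show "T \<in> SSVT_Q lam n"
    unfolding SSVT_Q_def using le[OF adjacent(1)] le[OF adjacent(2)] column_eq row_eq by blast
qed

lemma SSVT_P_eq_set_fillings:
  assumes "strict_partition lam"
  shows "SSVT_P lam n = set_fillings (SYD lam) (P_alphabet n) same_line_before (repeatable n)"
proof -
  have sub: "unprimed ` {1..n} \<subseteq> alphabet n" by (simp add: alphabet_def)
  have "(T \<in> PiE (SYD lam) (\<lambda>b. Pow (P_alphabet n b) - {{}})) \<longleftrightarrow>
      T \<in> SYD lam \<rightarrow>\<^sub>E (Pow (alphabet n) - {{}}) \<and>
      (\<forall>i. (i, i) \<in> SYD lam \<longrightarrow> T (i, i) \<subseteq> unprimed ` {1..n})" for T
  proof -
    have "(\<forall>b\<in>SYD lam. T b \<in> Pow (P_alphabet n b) - {{}}) \<longleftrightarrow>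
        (\<forall>b\<in>SYD lam. T b \<in> Pow (alphabet n) - {{}}) \<and>
        (\<forall>b\<in>SYD lam. fst b = snd b \<longrightarrow> T b \<subseteq> unprimed ` {1..n})"
      (is "?p \<longleftrightarrow> ?q")
    proof
      have "P_alphabet n b \<subseteq> alphabet n" for b using sub by (simp add: P_alphabet_def)
      then show "?p \<Longrightarrow> ?q" by (fastforce simp: P_alphabet_def)
      show "?q \<Longrightarrow> ?p" by (simp add: P_alphabet_def)
    qed
    moreover have "(\<forall>b\<in>SYD lam. fst b = snd b \<longrightarrow> T b \<subseteq> unprimed ` {1..n}) \<longleftrightarrow>
        (\<forall>i. (i, i) \<in> SYD lam \<longrightarrow> T (i, i) \<subseteq> unprimed ` {1..n})"
      by (auto simp del: atLeastAtMost_iff One_nat_def) blast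
    ultimately show ?thesis unfolding PiE_iff by blast
  qed
  then show ?thesis
    unfolding SSVT_P_def SSVT_Q_eq_set_fillings[OF assms] set_fillings_def
    by (simp only: mem_Collect_eq conj_ac)
qed

section \<open>Specialization\<close>

lemma card_SYD: "card (SYD lam) = sum_list lam"
proof -
  have "SYD lam = (SIGMA i:{1..length lam}. {i..lam ! (i - 1) + i - 1})"
    by (auto simp: SYD_def)
  then have "card (SYD lam) = (\<Sum>i=1..length lam. lam ! (i - 1))"
    by (simp add: card_SigmaI)
  also have "\<dots> = (\<Sum>i<length lam. lam ! i)"
    by (rule sum.reindex_bij_witness[of _ Suc "\<lambda>i. i - 1"]) auto
  finally show ?thesis by (simp add: sum_list_sum_nth atLeast0LessThan)
qed

text \<open>Ensures that the exponent of the parameter is a true difference.\<close>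

lemma SSVT_Q_card_le_tab_size:
  assumes "T \<in> SSVT_Q lam n"
  shows "sum_list lam \<le> tab_size lam T"
proof -
  have "1 \<le> card (T b)" if "b \<in> SYD lam" for b
  proof -
    have "T b \<noteq> {}" "finite (T b)"
      using assms that finite_subset[OF _ finite_alphabet] by (auto simp: SSVT_Q_def PiE_iff)
    then show ?thesis by (simp add: Suc_le_eq card_gt_0_iff)
  qed
  then have "(\<Sum>b\<in>SYD lam. 1) \<le> tab_size lam T"
    unfolding tab_size_def by (rule sum_mono)
  then show ?thesis by (simp add: card_SYD)
qed

lemma primed_neq_unprimed: "primed k \<noteq> unprimed l"
proof
  assume "primed k = unprimed l"
  \<comment> \<open>Doubling clears the half and equates an even number with an odd one.\<close>
  then have "of_nat (2 * k) = (of_nat (2 * l + 1) :: rat)"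
    by (simp add: primed_def unprimed_def field_simps)
  then have "2 * k = 2 * l + 1" by (simp only: of_nat_eq_iff)
  then show False by presburger
qed

text \<open>The pairs \<open>{unprimed k, primed k}\<close> partition the alphabet. With all
  variables equal, the monomial of \<open>T\<close> therefore depends only on
  \<open>tab_size lam T\<close>.\<close>

lemma sum_weight:
  assumes "T \<in> SSVT_Q lam n"
  shows "(\<Sum>k=1..n. weight lam T k) = tab_size lam T"
proof -
  have "(\<Sum>k=1..n. card (T b \<inter> {unprimed k, primed k})) = card (T b)" if "b \<in> SYD lam" for b
  proof -
    have "T b \<subseteq> alphabet n" using assms that by (auto simp: SSVT_Q_def PiE_iff)
    then have "T b = (\<Union>k\<in>{1..n}. T b \<inter> {unprimed k, primed k})"
      by (auto simp: alphabet_def)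
    moreover have "card (\<Union>k\<in>{1..n}. T b \<inter> {unprimed k, primed k})
        = (\<Sum>k=1..n. card (T b \<inter> {unprimed k, primed k}))"
    proof (rule card_UN_disjoint, simp, simp, intro ballI impI)
      fix k l :: nat assume "k \<noteq> l"
      then have "unprimed k \<noteq> unprimed l" "primed k \<noteq> primed l"
        by (auto simp: unprimed_def primed_def)
      with primed_neq_unprimed[of k l] primed_neq_unprimed[of l k]
      show "T b \<inter> {unprimed k, primed k} \<inter> (T b \<inter> {unprimed l, primed l}) = {}"
        by (auto dest: sym)
    qed
    ultimately show ?thesis by simp
  qed
  then show ?thesis
    unfolding weight_def tab_size_def by (subst sum.swap) (rule sum.cong, auto)
qed

text \<open>Each excess entry contributes \<open>(- y) * x = -1\<close>. The sign is split into two
  powers so that the factor independent of \<open>T\<close> can leave the sum over tableaux.\<close>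

lemma specialized_term:
  fixes x y :: "'a::comm_ring_1"
  assumes T: "T \<in> SSVT_Q lam n" and inv: "x * y = 1"
  shows "(- y) ^ (tab_size lam T - sum_list lam) * (\<Prod>k=1..n. x ^ weight lam T k)
    = of_int ((-1) ^ sum_list lam * (-1) ^ tab_size lam T) * x ^ sum_list lam"
proof -
  obtain d where d: "tab_size lam T = sum_list lam + d"
    using SSVT_Q_card_le_tab_size[OF T] le_Suc_ex by blast
  have "(\<Prod>k=1..n. x ^ weight lam T k) = x ^ d * x ^ sum_list lam"
    unfolding power_sum[symmetric] sum_weight[OF T] d by (simp add: power_add mult.commute)
  moreover have "(- y) ^ d * x ^ d = (-1) ^ d"
    by (simp add: power_mult_distrib[symmetric] inv mult.commute[of y])
  moreover have "(-1) ^ sum_list lam * (-1) ^ tab_size lam T = (-1 :: int) ^ d"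
    by (simp add: d power_add mult.assoc[symmetric] power_mult_distrib[symmetric])
  ultimately show ?thesis by (simp add: d mult.assoc[symmetric])
qed

text \<open>The alphabet \<open>A\<close> stays arbitrary so that one argument serves both
  \<open>GP\<close> and \<open>GQ\<close>.\<close>

lemma specialized_sum:
  fixes x y :: "'a::comm_ring_1"
  assumes S: "S = set_fillings (SYD lam) A same_line_before (repeatable n)" "S \<subseteq> SSVT_Q lam n"
    and A: "\<And>b. finite (A b)" and ne: "S \<noteq> {}" and inv: "x * y = 1"
  shows "(\<Sum>T\<in>S. (- y) ^ (tab_size lam T - sum_list lam) * (\<Prod>k=1..n. x ^ weight lam T k))
    = x ^ sum_list lam"
proof -
  have rank: "fst a + snd a < fst b + snd b" if "same_line_before a b" for a b
    using that by (cases a; cases b) auto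
  have signs: "(\<Sum>T\<in>S. (-1 :: int) ^ tab_size lam T) = (-1) ^ sum_list lam"
    unfolding S(1) tab_size_def card_SYD[symmetric]
    by (rule set_fillings_signed_count[where r = "\<lambda>b. fst b + snd b", OF finite_SYD A rank])
      (use ne S(1) in auto)
  have "(\<Sum>T\<in>S. (- y) ^ (tab_size lam T - sum_list lam) * (\<Prod>k=1..n. x ^ weight lam T k))
    = (\<Sum>T\<in>S. of_int ((-1) ^ sum_list lam * (-1) ^ tab_size lam T) * x ^ sum_list lam)"
    using S(2) specialized_term[OF _ inv] by (intro sum.cong) auto
  also have "\<dots> = of_int ((-1) ^ sum_list lam * (\<Sum>T\<in>S. (-1) ^ tab_size lam T)) * x ^ sum_list lam"
    by (simp only: sum_distrib_right sum_distrib_left of_int_sum)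
  also have "\<dots> = x ^ sum_list lam"
    \<comment> \<open>The signed count supplies a second factor \<open>(-1) ^ sum_list lam\<close>,
      which cancels the first.\<close>
    unfolding signs by (simp add: power_mult_distrib[symmetric])
  finally show ?thesis .
qed

theorem theorem3p1:
  fixes lam :: "nat list" and n :: nat
  assumes "strict_partition lam"
    and "n \<ge> 1"
    and "SSVT_P lam n \<noteq> {}"
    and "SSVT_Q lam n \<noteq> {}"
  shows "GP lam n (\<lambda>_. lbeta) (- lbeta_inv) = lbeta ^ sum_list lam \<and>
         GQ lam n (\<lambda>_. lbeta) (- lbeta_inv) = lbeta ^ sum_list lam"
  unfolding GP_def GQ_def
proof
  show "(\<Sum>T\<in>SSVT_P lam n. (- lbeta_inv) ^ (tab_size lam T - sum_list lam) *
      (\<Prod>k=1..n. lbeta ^ weight lam T k)) = lbeta ^ sum_list lam"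
    by (rule specialized_sum[OF SSVT_P_eq_set_fillings[OF assms(1)] _ _ assms(3) lbeta_mult_inv])
      (auto simp: SSVT_P_def P_alphabet_def finite_alphabet)
  show "(\<Sum>T\<in>SSVT_Q lam n. (- lbeta_inv) ^ (tab_size lam T - sum_list lam) *
      (\<Prod>k=1..n. lbeta ^ weight lam T k)) = lbeta ^ sum_list lam"
    by (rule specialized_sum[OF SSVT_Q_eq_set_fillings[OF assms(1)] _ _ assms(4) lbeta_mult_inv])
      (auto simp: finite_alphabet)
qed

end
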